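(* For every positive integer $n$ there exists a reversible circuit over the gate set $\{\text{Toffoli}, \mathsf{CNOT}, \mathsf{X}\}$ that implements the in-place addition operator $\mathsf{Add}_n$ using $n-1$ ancilla qubits, with a Toffoli-count of $O(n\log n)$ and a Toffoli-depth of $O(\log^2 n)$ (as $n\to\infty$).
   Context: $\log$ denotes the binary logarithm. The operator $\mathsf{Add}_n$ acts on $2n+1$ qubits: for $n$-bit integers $a, b \in \{0,\dots,2^n-1\}$ (each stored in binary in an $n$-qubit register) and $z\in\{0,1\}$, $$\mathsf{Add}_n : |a\rangle\,|b\rangle\,|z\rangle \longmapsto |a\rangle\,|a+b \bmod 2^n\rangle\,|z\oplus (a+b)_n\rangle,$$ where $(a+b)_n$ is the bit of weight $2^n$ in the binary expansion of $a+b$ (the final carry). Gates: $\mathsf{X}$ maps $|x\rangle\mapsto|x\oplus 1\rangle$; $\mathsf{CNOT}$ maps $|x\rangle|y\rangle\mapsto|x\rangle|y\oplus x\rangle$; the Toffoli gate maps $|x\rangle|y\rangle|t\rangle\mapsto|x\rangle|y\rangle|t\oplus xy\rangle$. Gates may be applied to arbitrary (distinct) qubits, with no connectivity restriction. A circuit implements $\mathsf{Add}_n$ with $k$ ancilla qubits if it acts on $2n+1+k$ qubits and, when the $k$ ancilla qubits are initialized to $|0\rangle$, it applies $\mathsf{Add}_n$ to the other $2n+1$ qubits and returns all ancilla qubits to $|0\rangle$ at the end. The Toffoli-count of a circuit is its number of Toffoli gates. The Toffoli-depth is the number of Toffoli layers, where a layer consists of Toffoli gates acting on pairwise disjoint sets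 of qubits and executed in parallel ($\mathsf{CNOT}$ and $\mathsf{X}$ gates are not counted). *)

theory Defs
  imports Complex_Main "HOL-Library.Landau_Symbols"
begin

text \<open>A computational basis state of \<open>N\<close> qubits is a bit list of length \<open>N\<close>; a (not
  necessarily normalised) state vector is the function giving its amplitudes.\<close>

type_synonym state = "bool list \<Rightarrow> complex"

definition states :: "nat \<Rightarrow> state set" where
  "states N = {\<psi>. \<forall>x. length x \<noteq> N \<longrightarrow> \<psi> x = 0}"

definition ket :: "bool list \<Rightarrow> state" where
  "ket x = (\<lambda>y. if y = x then 1 else 0)"

text \<open>The first factor lives on the first \<open>M\<close> qubits.\<close>

definition tensor :: "nat \<Rightarrow> state \<Rightarrow> state \<Rightarrow> state" where
  "tensor M \<psi> \<phi> = (\<lambda>x. \<psi> (take M x) * \<phi> (drop M x))"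

text \<open>The linear operator on \<open>N\<close> qubits that maps \<open>ket x\<close> to \<open>ket (f x)\<close> for every
  basis state \<open>x\<close>.\<close>

definition lin_op :: "nat \<Rightarrow> (bool list \<Rightarrow> bool list) \<Rightarrow> state \<Rightarrow> state" where
  "lin_op N f \<psi> = (\<lambda>y. \<Sum>x | length x = N \<and> f x = y. \<psi> x)"

lemma finite_basis: "finite {x :: bool list. length x = N}"
  using finite_lists_length_eq[of "UNIV :: bool set" N] by simp

lemma lin_op_ket:
  assumes "length x = N"
  shows "lin_op N f (ket x) = ket (f x)"
proof
  fix y
  have "finite {u. length u = N \<and> f u = y}"
    by (rule finite_subset[OF _ finite_basis[of N]]) auto
  then show "lin_op N f (ket x) y = ket (f x) y"
    using assms by (auto simp: lin_op_def ket_def sum.delta)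
qed


text \<open>Controls come first, the target qubit last.\<close>

datatype gate = Pauli_X nat | CNOT nat nat | Toffoli nat nat nat

fun qubits :: "gate \<Rightarrow> nat list" where
  "qubits (Pauli_X t) = [t]"
| "qubits (CNOT c t) = [c, t]"
| "qubits (Toffoli c d t) = [c, d, t]"

fun is_toffoli :: "gate \<Rightarrow> bool" where
  "is_toffoli (Toffoli _ _ _) = True"
| "is_toffoli _ = False"

fun gate_map :: "gate \<Rightarrow> bool list \<Rightarrow> bool list" where
  "gate_map (Pauli_X t) x = x[t := (\<not> x ! t)]"
| "gate_map (CNOT c t) x = x[t := (x ! t \<noteq> x ! c)]"
| "gate_map (Toffoli c d t) x = x[t := (x ! t \<noteq> (x ! c \<and> x ! d))]"

text \<open>A circuit is a sequence of layers. Distinctness of the concatenated qubit lists says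
  both that each gate acts on distinct qubits and that the gates of one layer act on
  pairwise disjoint sets of qubits; these gates therefore commute, and executing a layer in
  parallel is the same as applying its gates one after the other.\<close>

type_synonym circuit = "gate list list"

definition valid_layer :: "nat \<Rightarrow> gate list \<Rightarrow> bool" where
  "valid_layer N L \<longleftrightarrow>
     distinct (concat (map qubits L)) \<and> (\<forall>q \<in> set (concat (map qubits L)). q < N)"

definition valid_circuit :: "nat \<Rightarrow> circuit \<Rightarrow> bool" where
  "valid_circuit N C \<longleftrightarrow> (\<forall>L \<in> set C. valid_layer N L)"

definition circuit_op :: "nat \<Rightarrow> circuit \<Rightarrow> state \<Rightarrow> state" where
  "circuit_op N C = fold (\<lambda>g. lin_op N (gate_map g)) (concat C)"

definition toffoli_count :: "circuit \<Rightarrow> nat" where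
  "toffoli_count C = length (filter is_toffoli (concat C))"

definition toffoli_depth :: "circuit \<Rightarrow> nat" where
  "toffoli_depth C = length (filter (\<lambda>L. \<exists>g \<in> set L. is_toffoli g) C)"


text \<open>Registers are little-endian: bit \<open>i\<close> has weight \<open>2 ^ i\<close>.\<close>

definition to_bits :: "nat \<Rightarrow> nat \<Rightarrow> bool list" where
  "to_bits n a = map (bit a) [0..<n]"

definition of_bits :: "bool list \<Rightarrow> nat" where
  "of_bits bs = horner_sum of_bool 2 bs"

definition add_map :: "nat \<Rightarrow> bool list \<Rightarrow> bool list" where
  "add_map n x =
    (let a = of_bits (take n x); b = of_bits (take n (drop n x)); z = x ! (2 * n)
     in to_bits n a @ to_bits n ((a + b) mod 2 ^ n) @ [z \<noteq> bit (a + b) n])"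

definition Add :: "nat \<Rightarrow> state \<Rightarrow> state" where
  "Add n = lin_op (2 * n + 1) (add_map n)"

lemma of_bits_to_bits: "a < 2 ^ n \<Longrightarrow> of_bits (to_bits n a) = a"
  by (simp add: of_bits_def to_bits_def horner_sum_bit_eq_take_bit take_bit_nat_eq_self)

lemma Add_ket:
  assumes "a < 2 ^ n" "b < 2 ^ n"
  shows "Add n (ket (to_bits n a @ to_bits n b @ [z])) =
    ket (to_bits n a @ to_bits n ((a + b) mod 2 ^ n) @ [z \<noteq> bit (a + b) n])"
proof -
  have l: "length (to_bits n c) = n" for c
    by (simp add: to_bits_def)
  have "add_map n (to_bits n a @ to_bits n b @ [z]) =
      to_bits n a @ to_bits n ((a + b) mod 2 ^ n) @ [z \<noteq> bit (a + b) n]"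
    using assms by (simp add: add_map_def l of_bits_to_bits nth_append)
  then show ?thesis
    by (simp add: Add_def lin_op_ket l)
qed

text \<open>The ancilla qubits are the last \<open>k\<close> ones.\<close>

definition implements_Add :: "nat \<Rightarrow> nat \<Rightarrow> circuit \<Rightarrow> bool" where
  "implements_Add n k C \<longleftrightarrow>
     valid_circuit (2 * n + 1 + k) C \<and>
     (\<forall>\<psi> \<in> states (2 * n + 1).
        circuit_op (2 * n + 1 + k) C (tensor (2 * n + 1) \<psi> (ket (replicate k False))) =
        tensor (2 * n + 1) (Add n \<psi>) (ket (replicate k False)))"

end

theory Submission
  imports Defs
begin

text \<open>A carry-lookahead adder whose prefix tree works in place. With \<open>p = a \<oplus> b\<close> stored over \<open>b\<close> and
  \<open>g = a b\<close> in an ancilla, the carries arise from the sequence of gates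
  \<open>c\<^bsub>i+1\<^esub> = g\<^sub>i \<oplus> p\<^sub>i c\<^sub>i\<close>. Since \<open>p\<close> and \<open>g\<close> are never both set, two neighbouring pairs are in one of only nine
  states, of which one has group propagate \<open>P = 1\<close> and four have group generate \<open>G = 1\<close>. Hence
  \<open>(P, G)\<close> and enough information to undo the step fit into the same four qubits, and the
  recursion on half as many pairs needs no further ancillas; it takes depth \<open>O(log n)\<close> and
  \<open>O(n)\<close> Toffoli gates, which is more than enough. Once the sum \<open>s\<close> is formed, the carries are
  uncomputed by running the same circuit backwards on \<open>a\<close> and the complement of \<open>s\<close>, an addition with
  the same carries as that of \<open>a\<close> and \<open>b\<close>.\<close>


section \<open>Gates as maps on bit assignments: locality, inversion, commutation\<close>

text \<open>Assignments to all natural numbers avoid length conditions throughout the correctness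
  argument; \<open>nth_fold_gate_map\<close> transfers the results to bit lists.\<close>

fun act :: "gate \<Rightarrow> (nat \<Rightarrow> bool) \<Rightarrow> nat \<Rightarrow> bool" where
  "act (Pauli_X t) s = s(t := (\<not> s t))"
| "act (CNOT c t) s = s(t := (s t \<noteq> s c))"
| "act (Toffoli c d t) s = s(t := (s t \<noteq> (s c \<and> s d)))"

fun target :: "gate \<Rightarrow> nat" where
  "target (Pauli_X t) = t"
| "target (CNOT c t) = t"
| "target (Toffoli c d t) = t"

abbreviation run :: "gate list \<Rightarrow> (nat \<Rightarrow> bool) \<Rightarrow> nat \<Rightarrow> bool" where
  "run \<equiv> fold act"

lemma target_in_qubits: "target g \<in> set (qubits g)"
  by (cases g) auto

lemma act_other: "q \<noteq> target g \<Longrightarrow> act g s q = s q"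
  by (cases g) auto

lemma run_other: "(\<And>g. g \<in> set gs \<Longrightarrow> target g \<noteq> q) \<Longrightarrow> run gs s q = s q"
proof (induction gs arbitrary: s)
  case (Cons g gs)
  then have "run gs (act g s) q = act g s q" and "q \<noteq> target g"
    by auto
  then show ?case
    by (simp add: act_other)
qed simp

lemma act_act: "distinct (qubits g) \<Longrightarrow> act g (act g s) = s"
  by (cases g) (auto simp: fun_eq_iff)

lemma run_rev:
  "(\<And>g. g \<in> set gs \<Longrightarrow> distinct (qubits g)) \<Longrightarrow> run (rev gs) (run gs s) = s"
  by (induction gs arbitrary: s) (auto simp: act_act)

text \<open>A sufficient condition for commutation: shared controls are allowed, shared targets are
  not.\<close>

definition indep :: "gate \<Rightarrow> gate \<Rightarrow> bool" where
  "indep g h \<longleftrightarrow> target g \<notin> set (qubits h) \<and> target h \<notin> set (qubits g)"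

lemma act_commute: "indep g h \<Longrightarrow> act g (act h s) = act h (act g s)"
  by (cases g; cases h) (auto simp: indep_def fun_eq_iff)

lemma run_act_commute:
  "(\<And>h. h \<in> set gs \<Longrightarrow> indep g h) \<Longrightarrow> run gs (act g s) = act g (run gs s)"
proof (induction gs arbitrary: s)
  case (Cons h gs)
  then have "act h (act g s) = act g (act h s)"
    by (intro act_commute[symmetric]) simp
  then show ?case
    using Cons by simp
qed simp

lemma run_commute:
  "(\<And>g h. g \<in> set A \<Longrightarrow> h \<in> set B \<Longrightarrow> indep g h) \<Longrightarrow> run B (run A s) = run A (run B s)"
  by (induction A arbitrary: s) (auto simp: run_act_commute)

text \<open>\<open>Q\<close> bounds the qubits touched and \<open>T\<close> those changed, so that a
  carry qubit that is only read can be told apart.\<close>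

definition confined :: "gate list \<Rightarrow> nat set \<Rightarrow> nat set \<Rightarrow> bool" where
  "confined gs Q T \<longleftrightarrow> (\<forall>g \<in> set gs. set (qubits g) \<subseteq> Q \<and> target g \<in> T)"

lemma confined_commute:
  assumes "confined A Q T" "confined B Q' T'" "T \<inter> Q' = {}" "T' \<inter> Q = {}"
  shows "run B (run A s) = run A (run B s)"
  by (rule run_commute) (use assms in \<open>unfold confined_def indep_def, blast\<close>)

section \<open>Parallel and block-by-block execution\<close>

text \<open>\<open>par\<close> is the circuit whose depth is measured, one layer per entry of
  \<open>fs\<close> across all blocks. \<open>ser\<close> finishes one block before starting the
  next, which suits induction over the blocks.\<close>

definition par :: "('b \<Rightarrow> gate) list \<Rightarrow> 'b list \<Rightarrow> circuit" where
  "par fs bs = map (\<lambda>f. map f bs) fs"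

definition ser :: "('b \<Rightarrow> gate) list \<Rightarrow> 'b list \<Rightarrow> gate list" where
  "ser fs bs = concat (map (\<lambda>b. map (\<lambda>f. f b) fs) bs)"

lemma ser_simps [simp]: "ser fs [] = []" "ser fs (b # bs) = map (\<lambda>f. f b) fs @ ser fs bs"
  by (auto simp: ser_def)

lemma run_par_Cons:
  assumes "\<And>f f' b'. f \<in> set fs \<Longrightarrow> f' \<in> set fs \<Longrightarrow> b' \<in> set bs \<Longrightarrow> indep (f b) (f' b')"
  shows "run (concat (par fs (b # bs))) s = run (concat (par fs bs)) (run (map (\<lambda>f. f b) fs) s)"
  using assms
proof (induction fs arbitrary: s)
  case (Cons f fs)
  have "run (map f bs) (run (map (\<lambda>f. f b) fs) t) = run (map (\<lambda>f. f b) fs) (run (map f bs) t)" for t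
    by (rule run_commute) (use Cons.prems in auto)
  then show ?case
    using Cons by (simp add: par_def)
qed (simp add: par_def)

text \<open>All gates of the first block can be moved to the front, since they commute with those of
  later blocks. Gates of the same block keep their order and may depend on each other.\<close>

lemma run_par:
  assumes "sorted_wrt (\<lambda>b b'. \<forall>f \<in> set fs. \<forall>f' \<in> set fs. indep (f b) (f' b')) bs"
  shows "run (concat (par fs bs)) s = run (ser fs bs) s"
  using assms
proof (induction bs arbitrary: s)
  case Nil
  then show ?case by (induction fs) (auto simp: par_def)
next
  case (Cons b bs)
  then show ?case by (subst run_par_Cons) auto
qed

text \<open>Consecutive blocks share a qubit, the carry between them; every second block taken
  separately, they can be run in parallel.\<close>

fun evens :: "'b list \<Rightarrow> 'b list" where
  "evens (x # y # r) = x # evens r"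
| "evens r = r"

lemma set_evens: "set (evens xs) \<subseteq> set xs"
  by (induction xs rule: evens.induct) auto

lemma sorted_wrt_evens: "sorted_wrt R xs \<Longrightarrow> sorted_wrt R (evens xs)"
  by (induction xs rule: evens.induct) (use set_evens in fastforce)+

lemma evens_Cons: "evens (x # xs) = x # evens (tl xs)"
  by (cases xs) auto

lemma length_evens: "length (evens xs) + length (evens (tl xs)) = length xs"
proof -
  have "length (evens ys) = (length ys + 1) div 2" for ys :: "'a list"
    by (induction ys rule: evens.induct) auto
  then show ?thesis
    by (simp, presburger)
qed

text \<open>Adjacent blocks may share a control: their gates then commute but cannot lie in one
  layer. Hence the order of the blocks is free while two batches are required.\<close>

lemma run_evens_odds:
  assumes "sorted_wrt (\<lambda>b b'. \<forall>f \<in> set fs. \<forall>f' \<in> set fs. indep (f b) (f' b')) bs"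
  shows "run (ser fs (evens (tl bs))) (run (ser fs (evens bs)) s) = run (ser fs bs) s"
  using assms
proof (induction bs arbitrary: s rule: evens.induct)
  case (1 x y r)
  \<comment> \<open>\<open>y\<close> precedes every block of \<open>evens r\<close> in the list, so
    it can be pulled in front of them.\<close>
  have "run (map (\<lambda>f. f y) fs) (run (ser fs (evens r)) t) =
      run (ser fs (evens r)) (run (map (\<lambda>f. f y) fs) t)" for t
    using "1.prems" set_evens[of r]
    by (intro run_commute[symmetric]) (fastforce simp: ser_def indep_def)
  then show ?case
    using 1 by (simp add: evens_Cons)
qed auto

section \<open>Merging and splitting neighbouring pairs: one level of the prefix tree\<close>

type_synonym block = "nat \<times> nat \<times> nat \<times> nat \<times> nat"

text \<open>The linear-depth reference circuit: \<open>c\<close> holds the incoming carry, and each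
  generate qubit becomes the next carry.\<close>

fun ladder :: "nat \<Rightarrow> (nat \<times> nat) list \<Rightarrow> gate list" where
  "ladder c [] = []"
| "ladder c ((p, g) # ps) = Toffoli p c g # ladder g ps"

fun blocks :: "nat \<Rightarrow> (nat \<times> nat) list \<Rightarrow> block list" where
  "blocks c ((p0, g0) # (p1, g1) # ps) = (c, p0, g0, p1, g1) # blocks g1 ps"
| "blocks c ps = []"

fun unpaired :: "nat \<Rightarrow> (nat \<times> nat) list \<Rightarrow> gate list" where
  "unpaired c ((p0, g0) # (p1, g1) # ps) = unpaired g1 ps"
| "unpaired c [(p, g)] = [Toffoli p c g]"
| "unpaired c [] = []"

text \<open>In a block \<open>(c, p0, g0, p1, g1)\<close>, \<open>c\<close> holds the incoming carry. Merging leaves the group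
  propagate in \<open>g0\<close> and the group generate in \<open>g1\<close>. Splitting is not the inverse of merging: by then
  \<open>g1\<close> holds the outgoing carry, and \<open>g0\<close> receives the carry in the middle. It never changes \<open>g1\<close>,
  which the next block uses as incoming carry.\<close>

definition merge_gates :: "(block \<Rightarrow> gate) list" where
  "merge_gates =
    [\<lambda>(c, p0, g0, p1, g1). Toffoli p1 g0 g1,
     \<lambda>(c, p0, g0, p1, g1). Toffoli p1 g1 g0,
     \<lambda>(c, p0, g0, p1, g1). Toffoli p0 p1 g0,
     \<lambda>(c, p0, g0, p1, g1). CNOT g0 p0,
     \<lambda>(c, p0, g0, p1, g1). Toffoli p0 g0 p1,
     \<lambda>(c, p0, g0, p1, g1). Toffoli p0 p1 g0]"

definition split_gates :: "(block \<Rightarrow> gate) list" where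
  "split_gates =
    [\<lambda>(c, p0, g0, p1, g1). Toffoli g0 c p0,
     \<lambda>(c, p0, g0, p1, g1). Toffoli p0 p1 g0,
     \<lambda>(c, p0, g0, p1, g1). Toffoli p0 g0 p1,
     \<lambda>(c, p0, g0, p1, g1). CNOT g0 p0,
     \<lambda>(c, p0, g0, p1, g1). Toffoli p0 p1 g0,
     \<lambda>(c, p0, g0, p1, g1). Toffoli p1 g1 g0,
     \<lambda>(c, p0, g0, p1, g1). Toffoli p0 c g0]"

abbreviation merged :: "block list \<Rightarrow> (nat \<times> nat) list" where
  "merged \<equiv> map (\<lambda>(c, p0, g0, p1, g1). (g0, g1))"

definition locs :: "(nat \<times> nat) list \<Rightarrow> nat list" where
  "locs ps = concat (map (\<lambda>(p, g). [p, g]) ps)"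

lemma locs_simps [simp]: "locs [] = []" "locs ((p, g) # ps) = p # g # locs ps"
  by (auto simp: locs_def)

lemma length_blocks: "length (blocks c ps) = length ps div 2"
  by (induction c ps rule: blocks.induct) auto

text \<open>The invariant behind the nine-state encoding: a position cannot both propagate and
  generate.\<close>

definition exclusive :: "(nat \<Rightarrow> bool) \<Rightarrow> (nat \<times> nat) list \<Rightarrow> bool" where
  "exclusive s ps \<longleftrightarrow> (\<forall>(p, g) \<in> set ps. \<not> (s p \<and> s g))"

lemma exclusive_simps [simp]:
  "exclusive s []"
  "exclusive s ((p, g) # ps) \<longleftrightarrow> \<not> (s p \<and> s g) \<and> exclusive s ps"
  by (auto simp: exclusive_def)

lemma exclusive_cong:
  "(\<And>q. q \<in> set (locs ps) \<Longrightarrow> s q = s' q) \<Longrightarrow> exclusive s ps = exclusive s' ps"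
  by (induction ps) auto

text \<open>Gates two to six of splitting undo the last five gates of merging. If the group does not
  propagate, \<open>g1\<close> still holds the group generate and the undoing is exact. If it does,
  \<open>g1\<close> holds \<open>c\<close>; the first gate of splitting puts \<open>c\<close> into
  \<open>p0\<close> as well, which compensates for this. The last gate turns the restored
  \<open>g0\<close> into the middle carry. The cases are checked on all assignments to the five
  qubits.\<close>

lemma merge_block:
  assumes "distinct [c, p0, g0, p1, g1]" "\<not> (s p0 \<and> s g0)" "\<not> (s p1 \<and> s g1)"
  shows "run (map (\<lambda>f. f (c, p0, g0, p1, g1)) split_gates)
           (act (Toffoli g0 c g1)
             (run (map (\<lambda>f. f (c, p0, g0, p1, g1)) merge_gates) s)) =
         act (Toffoli p1 g0 g1) (act (Toffoli p0 c g0) s)" (is "?l = ?r")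
    and "\<not> (run (map (\<lambda>f. f (c, p0, g0, p1, g1)) merge_gates) s g0 \<and>
            run (map (\<lambda>f. f (c, p0, g0, p1, g1)) merge_gates) s g1)"
proof -
  have ne: "p0 \<noteq> c" "g0 \<noteq> c" "p1 \<noteq> c" "g1 \<noteq> c" "g0 \<noteq> p0" "p1 \<noteq> p0" "g1 \<noteq> p0"
    "p1 \<noteq> g0" "g1 \<noteq> g0" "g1 \<noteq> p1"
    using assms(1) by auto
  note ne = ne ne[symmetric]
  have "?l q = ?r q" if "q = c \<or> q = p0 \<or> q = g0 \<or> q = p1 \<or> q = g1" for q
    using that assms(2,3) unfolding merge_gates_def split_gates_def
    by (elim disjE; cases "s c"; cases "s p0"; cases "s g0"; cases "s p1"; cases "s g1")
      (simp_all add: ne)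
  moreover have "?l q = ?r q" if q: "q \<noteq> p0" "q \<noteq> g0" "q \<noteq> p1" "q \<noteq> g1" for q
  proof -
    have "run (map (\<lambda>f. f (c, p0, g0, p1, g1)) split_gates) t q = t q"
      "run (map (\<lambda>f. f (c, p0, g0, p1, g1)) merge_gates) t q = t q" for t
      by (intro run_other; use q in \<open>auto simp: split_gates_def merge_gates_def\<close>)+
    then show ?thesis
      using q by simp
  qed
  ultimately have "?l q = ?r q" for q
    by metis
  then show "?l = ?r" ..
  show "\<not> (run (map (\<lambda>f. f (c, p0, g0, p1, g1)) merge_gates) s g0 \<and>
            run (map (\<lambda>f. f (c, p0, g0, p1, g1)) merge_gates) s g1)"
    using assms(2,3) unfolding merge_gates_def
    by (cases "s c"; cases "s p0"; cases "s g0"; cases "s p1"; cases "s g1") (simp_all add: ne)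
qed

text \<open>The incoming carry \<open>c\<close> is not touched, which makes the merge gates of
  different blocks disjoint.\<close>

lemma confined_merge:
  "confined (ser merge_gates (blocks c ps)) (set (locs ps)) (set (locs ps))"
  by (induction c ps rule: blocks.induct) (auto simp: merge_gates_def confined_def)

lemma confined_ladder:
  "confined (ladder c (merged (blocks c ps))) (insert c (set (locs ps))) (set (locs ps))"
  by (induction c ps rule: blocks.induct) (auto simp: confined_def)

text \<open>A group propagates only if \<open>p0\<close> and \<open>p1\<close> are set; then neither
  \<open>g0\<close> nor \<open>g1\<close> is, and nothing is generated. So the recursion may rely on
  the invariant again.\<close>

lemma exclusive_merged:
  assumes "distinct (c # locs ps)" "exclusive s ps"
  shows "exclusive (run (ser merge_gates (blocks c ps)) s) (merged (blocks c ps))"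
  using assms
proof (induction c ps arbitrary: s rule: blocks.induct)
  case (1 c p0 g0 p1 g1 ps)
  let ?s = "run (map (\<lambda>f. f (c, p0, g0, p1, g1)) merge_gates) s"
  have other: "?s q = s q" if "q \<in> set (locs ps)" for q
    by (rule run_other) (use that 1 in \<open>auto simp: merge_gates_def\<close>)
  have "exclusive ?s ps"
    using exclusive_cong[of ps ?s s] other 1 by simp
  then have IH: "exclusive (run (ser merge_gates (blocks g1 ps)) ?s) (merged (blocks g1 ps))"
    using 1 by simp
  have "run (ser merge_gates (blocks g1 ps)) ?s q = ?s q" if "q \<in> {g0, g1}" for q
    by (rule run_other) (use that 1(2) confined_merge[of g1 ps] in \<open>auto simp: confined_def\<close>)
  moreover have "\<not> (?s g0 \<and> ?s g1)"
    by (rule merge_block) (use 1 in auto)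
  ultimately show ?case
    using IH by simp
qed auto

text \<open>The ladder gate and the splitting of the first block are moved before all gates of later
  blocks. By \<open>merge_block\<close> the first block then amounts to two ladder gates, and the
  induction hypothesis covers the rest, with \<open>g1\<close> as incoming carry.\<close>

lemma run_merge_ladder_split:
  assumes "distinct (c # locs ps)" "exclusive s ps"
  shows "run (unpaired c ps) (run (ser split_gates (blocks c ps))
           (run (ladder c (merged (blocks c ps))) (run (ser merge_gates (blocks c ps)) s))) =
         run (ladder c ps) s"
  using assms
proof (induction c ps arbitrary: s rule: blocks.induct)
  case (1 c p0 g0 p1 g1 ps)
  let ?b = "(c, p0, g0, p1, g1)"
  let ?M = "map (\<lambda>f. f ?b) merge_gates" and ?U = "map (\<lambda>f. f ?b) split_gates"
  let ?M' = "ser merge_gates (blocks g1 ps)" and ?L' = "ladder g1 (merged (blocks g1 ps))"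
  let ?T = "Toffoli g0 c g1"
  have "confined [?T] {g0, c, g1} {g1}"
    by (auto simp: confined_def)
  then have "run [?T] (run ?M' t) = run ?M' (run [?T] t)" for t
    by (rule confined_commute[OF confined_merge]) (use 1(2) in auto)
  then have T: "act ?T (run ?M' t) = run ?M' (act ?T t)" for t
    by simp
  \<comment> \<open>\<open>g1\<close> is only read by splitting and only read by the ladder of the
    later blocks, hence the smaller set of targets.\<close>
  have U: "confined ?U {c, p0, g0, p1, g1} {p0, g0, p1}"
    by (auto simp: confined_def split_gates_def)
  have UM: "run ?U (run ?M' t) = run ?M' (run ?U t)" for t
    by (rule confined_commute[OF confined_merge U]) (use 1(2) in auto)
  have UL: "run ?U (run ?L' t) = run ?L' (run ?U t)" for t
    by (rule confined_commute[OF confined_ladder U]) (use 1(2) in auto)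
  let ?s = "act (Toffoli p1 g0 g1) (act (Toffoli p0 c g0) s)"
  have "run ?U (act ?T (run ?M s)) = ?s"
    by (rule merge_block) (use 1 in auto)
  moreover have "exclusive ?s ps \<longleftrightarrow> exclusive s ps"
    by (rule exclusive_cong) (use 1(2) in auto)
  ultimately show ?case
    using 1 by (simp add: T UM UL del: act.simps)
qed auto

lemma confined_split:
  "confined (ser split_gates (blocks c ps)) (insert c (set (locs ps))) (set (locs ps))"
  by (induction c ps rule: blocks.induct) (auto simp: split_gates_def confined_def)

text \<open>Merge gates of different blocks are disjoint. Split gates of adjacent blocks meet only
  in the carry between them, which neither writes.\<close>

lemma indep_blocks:
  assumes "distinct (c # locs ps)" "fs = merge_gates \<or> fs = split_gates"
  shows "sorted_wrt (\<lambda>b b'. \<forall>f \<in> set fs. \<forall>f' \<in> set fs. indep (f b) (f' b')) (blocks c ps)"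
  using assms
proof (induction c ps rule: blocks.induct)
  case (1 c p0 g0 p1 g1 ps)
  have "indep (f (c, p0, g0, p1, g1)) (f' b')"
    if f: "f \<in> set fs" "f' \<in> set fs" and b': "b' \<in> set (blocks g1 ps)" for f f' b'
  proof -
    have "set (qubits (f' b')) \<subseteq> insert g1 (set (locs ps)) \<and> target (f' b') \<in> set (locs ps)"
      using "1.prems"(2)
    proof
      assume "fs = merge_gates"
      then have "f' b' \<in> set (ser merge_gates (blocks g1 ps))"
        using f b' by (auto simp: ser_def)
      then show ?thesis
        using confined_merge[of g1 ps] target_in_qubits by (fastforce simp: confined_def)
    next
      assume "fs = split_gates"
      then have "f' b' \<in> set (ser split_gates (blocks g1 ps))"
        using f b' by (auto simp: ser_def)
      then show ?thesis
        using confined_split[of g1 ps] by (auto simp: confined_def)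
    qed
    moreover have "set (qubits (f (c, p0, g0, p1, g1))) \<subseteq> {c, p0, g0, p1, g1}"
      using f(1) "1.prems"(2) by (auto simp: merge_gates_def split_gates_def)
    \<comment> \<open>Writing \<open>g1\<close> is harmless in merging, because the next block does
      not touch its incoming carry there.\<close>
    moreover have "target (f (c, p0, g0, p1, g1)) = g1 \<longrightarrow> fs = merge_gates"
      "target (f (c, p0, g0, p1, g1)) \<in> {p0, g0, p1, g1}"
      using f(1) 1(2-) by (auto simp: merge_gates_def split_gates_def)
    moreover have "set (qubits (f' b')) \<subseteq> set (locs ps)" if "fs = merge_gates"
      using confined_merge[of g1 ps] that f b' by (auto simp: confined_def ser_def)
    ultimately show ?thesis
      using 1(2) unfolding indep_def by auto
  qed
  then show ?case
    using 1 by simp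
qed auto

section \<open>The logarithmic-depth ladder and its correctness\<close>

text \<open>One batch suffices for merging, whereas splitting reads the incoming carry and so needs
  two. The last gate serves a list of odd length.\<close>

function fast_ladder :: "nat \<Rightarrow> (nat \<times> nat) list \<Rightarrow> circuit" where
  "fast_ladder c ps =
    (if length ps < 2 then [unpaired c ps]
     else par merge_gates (blocks c ps) @ fast_ladder c (merged (blocks c ps)) @
       par split_gates (evens (blocks c ps)) @ par split_gates (evens (tl (blocks c ps))) @
       [unpaired c ps])"
  by auto
termination
  by (relation "measure (length \<circ> snd)") (auto simp: length_blocks)

declare fast_ladder.simps [simp del]

lemma locs_merged: "set (locs (merged (blocks c ps))) \<subseteq> set (locs ps)"
  by (induction c ps rule: blocks.induct) auto

lemma distinct_merged: "distinct (c # locs ps) \<Longrightarrow> distinct (c # locs (merged (blocks c ps)))"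
proof (induction c ps rule: blocks.induct)
  case (1 c p0 g0 p1 g1 ps)
  then show ?case
    using locs_merged[of g1 ps] by auto
qed auto

text \<open>After passing from \<open>par\<close> to \<open>ser\<close>, the inner call is a plain
  ladder by induction, and \<open>run_merge_ladder_split\<close> collapses the level.\<close>

lemma run_fast_ladder:
  assumes "distinct (c # locs ps)" "exclusive s ps"
  shows "run (concat (fast_ladder c ps)) s = run (ladder c ps) s"
  using assms
proof (induction c ps arbitrary: s rule: fast_ladder.induct)
  case (1 c ps)
  show ?case
  proof (cases "length ps < 2")
    case True
    then have "unpaired c ps = ladder c ps"
      by (cases "(c, ps)" rule: unpaired.cases) auto
    then show ?thesis
      using True by (subst fast_ladder.simps) simp
  next
    case False
    let ?bs = "blocks c ps"
    let ?s = "run (ser merge_gates ?bs) s"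
    note indep = indep_blocks[OF "1.prems"(1)]
    have "run (concat (fast_ladder c (merged ?bs))) ?s = run (ladder c (merged ?bs)) ?s"
      using "1.IH"[OF False] distinct_merged[OF "1.prems"(1)] exclusive_merged[OF "1.prems"] by blast
    moreover have "sorted_wrt (\<lambda>b b'. \<forall>f \<in> set split_gates. \<forall>f' \<in> set split_gates.
        indep (f b) (f' b')) (tl ?bs)"
      using indep[of split_gates] by (cases ?bs) auto
    ultimately show ?thesis
      using False run_merge_ladder_split[OF "1.prems"] indep
      by (subst fast_ladder.simps) (simp add: run_par run_evens_odds sorted_wrt_evens)
  qed
qed

section \<open>Disjointness of the gates in each layer of the ladder\<close>

text \<open>A layer has one gate per block, so it suffices to reserve disjoint qubit lists
  \<open>qs b\<close> for the blocks.\<close>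

lemma valid_par:
  assumes "distinct (concat (map qs bs))" "\<And>b. b \<in> set bs \<Longrightarrow> set (qs b) \<subseteq> {..<N}"
    and "\<And>f b. f \<in> set fs \<Longrightarrow> b \<in> set bs \<Longrightarrow>
      distinct (qubits (f b)) \<and> set (qubits (f b)) \<subseteq> set (qs b)"
  shows "valid_circuit N (par fs bs)"
proof -
  have "valid_layer N (map f bs)" if "f \<in> set fs" for f
    using assms(1,2) assms(3)[OF that]
  proof (induction bs)
    case (Cons b bs)
    have "set (qubits (f b)) \<subseteq> set (qs b)" "distinct (qubits (f b))"
      using Cons.prems by auto
    moreover have "(\<Union>b\<in>set bs. set (qubits (f b))) \<subseteq> (\<Union>b\<in>set bs. set (qs b))"
      using Cons.prems by fastforce
    moreover have "valid_layer N (map f bs)"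
      using Cons by simp
    moreover have "set (qs b) \<inter> (\<Union>b\<in>set bs. set (qs b)) = {}" "set (qs b) \<subseteq> {..<N}"
      using Cons.prems by auto
    ultimately show ?case
      unfolding valid_layer_def by (simp add: comp_def) blast
  qed (simp add: valid_layer_def)
  then show ?thesis
    by (auto simp: valid_circuit_def par_def)
qed

lemma valid_append [simp]:
  "valid_circuit N (C @ D) \<longleftrightarrow> valid_circuit N C \<and> valid_circuit N D"
  by (auto simp: valid_circuit_def)

lemma blocks_subset:
  "b \<in> set (blocks c ps) \<Longrightarrow> case b of (c', p0, g0, p1, g1) \<Rightarrow>
    set [p0, g0, p1, g1] \<subseteq> set (locs ps) \<and> c' \<in> insert c (set (locs ps))"
  by (induction c ps rule: blocks.induct) auto

lemma valid_merge:
  assumes "distinct (locs ps)" "set (locs ps) \<subseteq> {..<N}"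
  shows "valid_circuit N (par merge_gates (blocks c ps))"
proof (rule valid_par)
  \<comment> \<open>The incoming carry is left out: it belongs to the previous block.\<close>
  let ?qs = "\<lambda>(c :: nat, p0, g0, p1, g1). [p0, g0, p1, g1 :: nat]"
  have sub: "set (concat (map ?qs (blocks c ps))) \<subseteq> set (locs ps)" for c ps
    using blocks_subset[of _ c ps] by fastforce
  have dis: "distinct (concat (map ?qs (blocks c ps)))"
    using assms(1)
  proof (induction c ps rule: blocks.induct)
    case (1 c p0 g0 p1 g1 ps)
    then show ?case
      using sub[of g1 ps] by (auto simp del: set_concat)
  qed auto
  then show "distinct (concat (map ?qs (blocks c ps)))" .
  show "set (?qs b) \<subseteq> {..<N}" if "b \<in> set (blocks c ps)" for b
    using blocks_subset[OF that] assms(2) by auto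
  show "distinct (qubits (f b)) \<and> set (qubits (f b)) \<subseteq> set (?qs b)"
    if "f \<in> set merge_gates" "b \<in> set (blocks c ps)" for f b
  proof -
    have "distinct (?qs b)"
      using dis that(2) by (auto simp: distinct_concat_iff)
    then show ?thesis
      using that(1) by (cases b) (auto simp: merge_gates_def)
  qed
qed

text \<open>A block meets its successor in \<open>g1\<close>, but not the block after that. The
  induction is on the length because each step drops four pairs.\<close>

lemma distinct_evens_blocks:
  assumes "distinct (c # locs ps)"
  shows "distinct (concat (map (\<lambda>(c, p0, g0, p1, g1). [c, p0, g0, p1, g1]) (evens (blocks c ps))))"
  using assms
proof (induction "length ps" arbitrary: c ps rule: less_induct)
  case less
  let ?qs = "\<lambda>(c :: nat, p0, g0, p1, g1). [c, p0, g0, p1, g1 :: nat]"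
  have sub: "set (concat (map ?qs (evens (blocks c ps)))) \<subseteq> insert c (set (locs ps))" for c ps
    using set_evens[of "blocks c ps"] blocks_subset[of _ c ps] by fastforce
  show ?case
  proof (cases "(c, ps)" rule: blocks.cases)
    case (1 c' p0 g0 p1 g1 r)
    show ?thesis
    proof (cases "(g1, r)" rule: blocks.cases)
      case (1 c'' p0' g0' p1' g1' r')
      then show ?thesis
        using \<open>(c, ps) = _\<close> less(1)[of r' g1'] less(2) sub[of g1' r']
        by (auto simp del: set_concat)
    qed (use 1 less(2) in auto)
  qed auto
qed

lemma valid_split:
  assumes "distinct (concat (map (\<lambda>(c, p0, g0, p1, g1). [c, p0, g0, p1, g1]) bs))"
    and "\<And>b. b \<in> set bs \<Longrightarrow> case b of (c, p0, g0, p1, g1) \<Rightarrow> set [c, p0, g0, p1, g1] \<subseteq> {..<N}"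
  shows "valid_circuit N (par split_gates bs)"
proof (rule valid_par[OF assms(1)])
  let ?qs = "\<lambda>(c :: nat, p0, g0, p1, g1). [c, p0, g0, p1, g1 :: nat]"
  show "set (?qs b) \<subseteq> {..<N}" if "b \<in> set bs" for b
    using assms(2)[OF that] by auto
  show "distinct (qubits (f b)) \<and> set (qubits (f b)) \<subseteq> set (?qs b)"
    if "f \<in> set split_gates" "b \<in> set bs" for f b
  proof -
    have "distinct (?qs b)"
      using assms(1) that(2) by (auto simp: distinct_concat_iff)
    then show ?thesis
      using that(1) by (cases b) (auto simp: split_gates_def)
  qed
qed

text \<open>The bound on \<open>c\<close> is conditional because for \<open>n = 1\<close> there are
  no ancillas: the list is then empty and the location \<open>2 * n + 1\<close> lies outside the
  circuit.\<close>

lemma valid_unpaired: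
  assumes "distinct (c # locs ps)" "set (locs ps) \<subseteq> {..<N}" "ps \<noteq> [] \<Longrightarrow> c < N"
  shows "valid_layer N (unpaired c ps)"
  using assms by (induction c ps rule: unpaired.induct) (auto simp: valid_layer_def)

lemma valid_fast_ladder:
  assumes "distinct (c # locs ps)" "set (locs ps) \<subseteq> {..<N}" "ps \<noteq> [] \<Longrightarrow> c < N"
  shows "valid_circuit N (fast_ladder c ps)"
  using assms
proof (induction c ps rule: fast_ladder.induct)
  case (1 c ps)
  let ?bs = "blocks c ps"
  have unpaired: "valid_circuit N [unpaired c ps]"
    using valid_unpaired[OF "1.prems"] by (simp add: valid_circuit_def)
  show ?case
  proof (cases "length ps < 2")
    case True
    then show ?thesis
      using unpaired by (subst fast_ladder.simps) simp
  next
    case False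
    then have "ps \<noteq> []"
      by auto
    then have "c < N"
      by (rule "1.prems"(3))
    have range: "case b of (c, p0, g0, p1, g1) \<Rightarrow> set [c, p0, g0, p1, g1] \<subseteq> {..<N}"
      if "b \<in> set ?bs" for b
      using blocks_subset[OF that] "1.prems"(2) \<open>c < N\<close> by auto
    have "valid_circuit N (fast_ladder c (merged ?bs))"
      using "1.IH"[OF False] distinct_merged[OF "1.prems"(1)] locs_merged[of c ps] "1.prems"(2)
        \<open>c < N\<close> by blast
    moreover have "valid_circuit N (par merge_gates ?bs)"
      by (rule valid_merge) (use "1.prems" in auto)
    moreover have "valid_circuit N (par split_gates (evens ?bs))"
      using distinct_evens_blocks[OF "1.prems"(1)] range set_evens[of ?bs]
      by (intro valid_split) blast+
    moreover have "valid_circuit N (par split_gates (evens (tl ?bs)))"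
    proof (rule valid_split)
      \<comment> \<open>The tail of the blocks is \<open>blocks g1 r\<close>, so the result on every
        second block applies from \<open>g1\<close> on.\<close>
      obtain p0 g0 p1 g1 r where ps: "ps = (p0, g0) # (p1, g1) # r"
        using False by (cases "(c, ps)" rule: blocks.cases) auto
      show "distinct (concat (map (\<lambda>(c, p0, g0, p1, g1). [c, p0, g0, p1, g1]) (evens (tl ?bs))))"
        using distinct_evens_blocks[of g1 r] "1.prems"(1) by (simp add: ps)
      show "case b of (c, p0, g0, p1, g1) \<Rightarrow> set [c, p0, g0, p1, g1] \<subseteq> {..<N}"
        if "b \<in> set (evens (tl ?bs))" for b
        using that set_evens[of "tl ?bs"] range[of b] list.set_sel(2)[of ?bs b] by (cases ?bs) auto
    qed
    ultimately show ?thesis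
      using False unpaired by (subst fast_ladder.simps) simp
  qed
qed

section \<open>Toffoli count and depth of the ladder\<close>

lemma toffoli_count_append [simp]: "toffoli_count (C @ D) = toffoli_count C + toffoli_count D"
  by (simp add: toffoli_count_def)

lemma toffoli_depth_append [simp]: "toffoli_depth (C @ D) = toffoli_depth C + toffoli_depth D"
  by (simp add: toffoli_depth_def)

lemma toffoli_count_single: "toffoli_count [L] \<le> length L"
  by (simp add: toffoli_count_def)

lemma toffoli_depth_le: "toffoli_depth C \<le> length C"
  by (simp add: toffoli_depth_def)

lemma toffoli_count_par: "toffoli_count (par fs bs) \<le> length fs * length bs"
proof -
  have "toffoli_count (par fs bs) \<le> length (concat (par fs bs))"
    by (simp add: toffoli_count_def)
  also have "\<dots> = length fs * length bs"
    by (induction fs) (auto simp: par_def)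
  finally show ?thesis .
qed

lemma length_unpaired: "length (unpaired c ps) \<le> 1"
  by (induction c ps rule: unpaired.induct) auto

text \<open>With \<open>b \<ge> 1\<close> blocks, merging costs at most \<open>6 * b\<close>,
  splitting \<open>7 * b\<close>, the unpaired gate 1 and the recursion \<open>14 * b\<close>; the
  total is at most \<open>28 * b\<close>. The counts 6 and 7 include the CNOT gates.\<close>

lemma toffoli_count_fast_ladder: "toffoli_count (fast_ladder c ps) \<le> 14 * length ps"
proof (induction c ps rule: fast_ladder.induct)
  case (1 c ps)
  have unpaired: "toffoli_count [unpaired c ps] \<le> 1"
    using toffoli_count_single length_unpaired le_trans by blast
  show ?case
  proof (cases "length ps < 2")
    case True
    then show ?thesis
      using unpaired by (subst fast_ladder.simps) (cases ps; simp add: toffoli_count_def)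
  next
    case False
    let ?bs = "blocks c ps"
    have "toffoli_count (fast_ladder c (merged ?bs)) \<le> 14 * length ?bs"
      using 1[OF False] by simp
    moreover have "toffoli_count (par merge_gates ?bs) \<le> 6 * length ?bs"
      using toffoli_count_par[of merge_gates ?bs] by (simp add: merge_gates_def)
    moreover have "toffoli_count (par split_gates bs) \<le> 7 * length bs" for bs
      using toffoli_count_par[of split_gates bs] by (simp add: split_gates_def)
    \<comment> \<open>The two batches together split each block only once.\<close>
    then have "toffoli_count (par split_gates (evens ?bs)) +
        toffoli_count (par split_gates (evens (tl ?bs))) \<le> 7 * length ?bs"
      by (metis add_mono distrib_left length_evens)
    ultimately show ?thesis
      using False unpaired length_blocks[of c ps]
      by (subst fast_ladder.simps) simp
  qed
qed

text \<open>A level adds at most 6 + 7 + 7 + 1 = 21 layers, and halving the length lowers the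
  logarithm by at least one. The maximum with 1 covers the empty list.\<close>

lemma toffoli_depth_fast_ladder:
  "real (toffoli_depth (fast_ladder c ps)) \<le> 1 + 21 * log 2 (max 1 (real (length ps)))"
proof (induction c ps rule: fast_ladder.induct)
  case (1 c ps)
  have unpaired: "toffoli_depth [unpaired c ps] \<le> 1"
    using toffoli_depth_le[of "[unpaired c ps]"] by simp
  show ?case
  proof (cases "length ps < 2")
    case True
    then show ?thesis
      using unpaired by (subst fast_ladder.simps)
        (auto intro!: order_trans[OF _ le_add_same_cancel1[THEN iffD2]])
  next
    case False
    let ?bs = "blocks c ps" and ?n = "length ps"
    have "?n div 2 \<ge> 1"
      using False by linarith
    then have "real (?n div 2) \<le> real ?n / 2" "real (?n div 2) \<ge> 1"
      by linarith+
    then have "log 2 (real (?n div 2)) \<le> log 2 (real ?n / 2)"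
      by (intro log_mono) linarith+
    also have "\<dots> = log 2 (real ?n) - 1"
      using False by (subst log_divide) auto
    finally have "log 2 (max 1 (real (length ?bs))) \<le> log 2 (real ?n) - 1"
      using \<open>real (?n div 2) \<ge> 1\<close> by (simp add: length_blocks)
    moreover have "real (toffoli_depth (fast_ladder c (merged ?bs))) \<le>
        1 + 21 * log 2 (max 1 (real (length ?bs)))"
      using 1[OF False] by simp
    moreover have "toffoli_depth (par merge_gates bs) \<le> 6"
      "toffoli_depth (par split_gates bs) \<le> 7" for bs
      by (rule order_trans[OF toffoli_depth_le];
          simp add: par_def merge_gates_def split_gates_def)+
    then have "toffoli_depth (par merge_gates ?bs) \<le> 6"
        "toffoli_depth (par split_gates (evens ?bs)) \<le> 7"
        "toffoli_depth (par split_gates (evens (tl ?bs))) \<le> 7"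
      by blast+
    moreover have "max 1 (real ?n) = real ?n"
      using False by simp
    ultimately show ?thesis
      using False unpaired by (subst fast_ladder.simps) simp
  qed
qed

section \<open>Carries of binary addition and the adder circuit\<close>

text \<open>The carry into position \<open>i\<close>. Exclusive or agrees with the usual
  disjunction, as generate and propagate exclude each other, and is what a Toffoli gate
  computes.\<close>

fun carry :: "(nat \<Rightarrow> bool) \<Rightarrow> (nat \<Rightarrow> bool) \<Rightarrow> nat \<Rightarrow> bool" where
  "carry x y 0 = False"
| "carry x y (Suc i) = ((x i \<and> y i) \<noteq> ((x i \<noteq> y i) \<and> carry x y i))"

lemma carry_cong:
  "(\<And>j. j < i \<Longrightarrow> x j = x' j) \<Longrightarrow> (\<And>j. j < i \<Longrightarrow> y j = y' j) \<Longrightarrow> carry x y i = carry x' y' i"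
  by (induction i) auto

text \<open>The next carry is a majority. If \<open>x i \<noteq> y i\<close>, the complemented sum
  bit is the carry itself, and the majority returns the carry; otherwise it is the opposite of the
  carry, and the majority returns \<open>x i\<close>. Both agree with the original addition.\<close>

lemma carry_not_sum: "carry x (\<lambda>i. \<not> ((y i \<noteq> x i) \<noteq> carry x y i)) i = carry x y i"
  by (induction i) auto

text \<open>The full-adder identity in each position; the carries telescope.\<close>

lemma sum_bits_add:
  "(\<Sum>i<n. of_bool (x i) * 2 ^ i) + (\<Sum>i<n. of_bool (y i) * 2 ^ i) =
    (\<Sum>i<n. of_bool ((y i \<noteq> x i) \<noteq> carry x y i) * 2 ^ i) + of_bool (carry x y n) * (2 ^ n :: nat)"
proof (induction n)
  case (Suc n)
  have "of_bool (x n) * 2 ^ n + of_bool (y n) * 2 ^ n + of_bool (carry x y n) * 2 ^ n =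
      of_bool ((y n \<noteq> x n) \<noteq> carry x y n) * 2 ^ n + of_bool (carry x y (Suc n)) * (2 ^ Suc n :: nat)"
    by (cases "x n"; cases "y n"; cases "carry x y n") simp_all
  with Suc show ?case
    by simp
qed simp

lemma bit_of_bits: "bit (of_bits bs) i \<longleftrightarrow> i < length bs \<and> bs ! i"
  by (simp add: of_bits_def bit_horner_sum_bit_iff)

lemma of_bits_sum: "of_bits bs = (\<Sum>i<length bs. of_bool (bs ! i) * 2 ^ i)"
  by (simp add: of_bits_def horner_sum_eq_sum atLeast0LessThan)

lemma add_map_carry:
  fixes v :: "bool list" and n :: nat
  defines "x \<equiv> \<lambda>i. v ! i" and "y \<equiv> \<lambda>i. v ! (n + i)"
  assumes "length v = 2 * n + 1"
  shows "add_map n v = map x [0..<n] @ map (\<lambda>i. (y i \<noteq> x i) \<noteq> carry x y i) [0..<n] @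
    [v ! (2 * n) \<noteq> carry x y n]"
proof -
  let ?a = "take n v" and ?b = "take n (drop n v)"
  \<comment> \<open>All \<open>n + 1\<close> bits of the sum: truncation drops the last bit, which
    is the final carry.\<close>
  let ?s = "map (\<lambda>i. (y i \<noteq> x i) \<noteq> carry x y i) [0..<n] @ [carry x y n]"
  have len: "length ?a = n" "length ?b = n"
    using assms(3) by auto
  have "of_bits ?a = (\<Sum>i<n. of_bool (x i) * 2 ^ i)"
    "of_bits ?b = (\<Sum>i<n. of_bool (y i) * 2 ^ i)"
    unfolding of_bits_sum len using assms(3) by (auto simp: x_def y_def intro!: sum.cong)
  moreover have "of_bits ?s = (\<Sum>i<n. of_bool ((y i \<noteq> x i) \<noteq> carry x y i) * 2 ^ i) +
      of_bool (carry x y n) * 2 ^ n"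
    unfolding of_bits_sum by (auto simp: nth_append intro!: sum.cong)
  ultimately have sum: "of_bits ?a + of_bits ?b = of_bits ?s"
    by (simp only: sum_bits_add)
  have "to_bits n (of_bits ?a) = map x [0..<n]"
    using assms(3) by (auto simp: to_bits_def bit_of_bits x_def)
  moreover have "to_bits n (of_bits ?s mod 2 ^ n) =
      map (\<lambda>i. (y i \<noteq> x i) \<noteq> carry x y i) [0..<n]"
    by (auto simp: to_bits_def bit_of_bits nth_append bit_take_bit_iff simp flip: take_bit_eq_mod)
  moreover have "bit (of_bits ?s) n = carry x y n"
    by (simp add: bit_of_bits nth_append)
  ultimately show ?thesis
    by (simp add: add_map_def sum Let_def)
qed

text \<open>The qubits \<open>i\<close>, \<open>n + i\<close> and \<open>2 * n + 1 + i\<close> hold \<open>a\<^sub>i\<close>, \<open>b\<^sub>i\<close> and the carry into position \<open>i + 1\<close>,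
  and \<open>2 * n\<close> is the qubit \<open>z\<close>.\<close>

definition carries :: "nat \<Rightarrow> circuit" where
  "carries n =
    par [\<lambda>i. Toffoli i (n + i) (2 * n + 1 + i), \<lambda>i. CNOT i (n + i)] [0..<n - 1] @
    fast_ladder (2 * n + 1) (map (\<lambda>i. (n + i, 2 * n + 1 + i)) [1..<n - 1]) @
    par [\<lambda>i. CNOT i (n + i)] [0..<n - 1]"

text \<open>The final carry is added directly to \<open>z\<close>, which need not be 0, so it stays
  outside the ladder. The CNOT gates form the top propagate bit and restore it. For
  \<open>n = 1\<close> there is no incoming carry, and \<open>3 * n - 1\<close> would be
  \<open>z\<close> itself.\<close>

definition top_carry :: "nat \<Rightarrow> circuit" where
  "top_carry n = [[Toffoli (n - 1) (2 * n - 1) (2 * n)], [CNOT (n - 1) (2 * n - 1)],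
    (if n \<ge> 2 then [Toffoli (2 * n - 1) (3 * n - 1) (2 * n)] else []), [CNOT (n - 1) (2 * n - 1)]]"

definition add_carries :: "nat \<Rightarrow> circuit" where
  "add_carries n =
    par [\<lambda>i. CNOT i (n + i)] [0..<n] @ par [\<lambda>i. CNOT (2 * n + 1 + i) (n + 1 + i)] [0..<n - 1]"

text \<open>The top sum bit is not complemented, since \<open>carries\<close> acts only on positions
  below \<open>n - 1\<close>.\<close>

definition flip :: "nat \<Rightarrow> circuit" where
  "flip n = par [\<lambda>i. Pauli_X (n + i)] [0..<n - 1]"

definition inverse_circuit :: "circuit \<Rightarrow> circuit" where
  "inverse_circuit C = rev (map rev C)"

definition adder :: "nat \<Rightarrow> circuit" where
  "adder n = carries n @ top_carry n @ add_carries n @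
    flip n @ inverse_circuit (carries n) @ flip n"

section \<open>Effect of the layers and of the carry computation\<close>

lemma run_Toffoli_layer:
  "m \<le> n \<Longrightarrow> run (map (\<lambda>i. Toffoli i (n + i) (2 * n + 1 + i)) [0..<m]) s =
    (\<lambda>q. if 2 * n + 1 \<le> q \<and> q < 2 * n + 1 + m
      then s q \<noteq> (s (q - (2 * n + 1)) \<and> s (q - (n + 1))) else s q)"
proof (induction m)
  case (Suc m)
  then show ?case
    by (auto simp: fun_eq_iff less_Suc_eq not_less)
qed auto

lemma run_CNOT_layer:
  "m \<le> n \<Longrightarrow> run (map (\<lambda>i. CNOT i (n + i)) [0..<m]) s =
    (\<lambda>q. if n \<le> q \<and> q < n + m then s q \<noteq> s (q - n) else s q)"
proof (induction m)
  case (Suc m)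
  then show ?case
    by (auto simp: fun_eq_iff less_Suc_eq not_less)
qed auto

lemma run_CNOT_carry_layer:
  "m \<le> n - 1 \<Longrightarrow> run (map (\<lambda>i. CNOT (2 * n + 1 + i) (n + 1 + i)) [0..<m]) s =
    (\<lambda>q. if n + 1 \<le> q \<and> q < n + 1 + m then s q \<noteq> s (q + n) else s q)"
proof (induction m)
  case (Suc m)
  then show ?case
    by (auto simp: fun_eq_iff less_Suc_eq not_less mult_2 add_ac)
qed auto

lemma run_X_layer:
  "run (map (\<lambda>i. Pauli_X (n + i)) [0..<m]) s = (\<lambda>q. if n \<le> q \<and> q < n + m then \<not> s q else s q)"
  by (induction m) (auto simp: fun_eq_iff less_Suc_eq not_less)

lemma ladder_snoc:
  "ladder c (ps @ [(p, g)]) = ladder c ps @ [Toffoli p (last (c # map snd ps)) g]"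
  by (induction c ps rule: ladder.induct) auto

text \<open>Induction on the number \<open>m\<close> of finished carries. It starts at 1: the carry
  into position 0 is \<open>False\<close>, so the generate bit of position 0 already is the carry
  into position 1.\<close>

lemma run_ladder_carry:
  assumes "m \<ge> 1" "m \<le> n - 1"
    and "\<And>i. i < n - 1 \<Longrightarrow> s (n + i) = (x i \<noteq> y i)"
    and "\<And>i. i < n - 1 \<Longrightarrow> s (2 * n + 1 + i) = (x i \<and> y i)"
  shows "run (ladder (2 * n + 1) (map (\<lambda>i. (n + i, 2 * n + 1 + i)) [1..<m])) s =
    (\<lambda>q. if 2 * n + 1 \<le> q \<and> q < 2 * n + 1 + m then carry x y (q - 2 * n) else s q)"
  using assms(1,2)
proof (induction m rule: nat_induct_at_least)
  case base
  have "carry x y (Suc 0) = s (2 * n + 1 + 0)"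
    using assms(1,2) by (subst assms(4)) auto
  then show ?case
    by (auto simp: fun_eq_iff less_Suc_eq)
next
  case (Suc m)
  \<comment> \<open>The carry into position \<open>m\<close> lies in qubit
    \<open>2 * n + 1 + (m - 1)\<close>, which for \<open>m = 1\<close> is the start of the
    ladder.\<close>
  have last: "last ((2 * n + 1) # map snd (map (\<lambda>i. (n + i, 2 * n + 1 + i)) [1..<m])) = 2 * n + m"
    using Suc.hyps by (cases m) (auto simp: last_map)
  let ?t = "\<lambda>q. if 2 * n + 1 \<le> q \<and> q < 2 * n + 1 + m then carry x y (q - 2 * n) else s q"
  have "run (ladder (2 * n + 1) (map (\<lambda>i. (n + i, 2 * n + 1 + i)) [1..<Suc m])) s =
      act (Toffoli (n + m) (2 * n + m) (2 * n + 1 + m))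
        (run (ladder (2 * n + 1) (map (\<lambda>i. (n + i, 2 * n + 1 + i)) [1..<m])) s)"
    unfolding last[symmetric] using Suc.hyps by (simp add: ladder_snoc)
  also have "\<dots> = act (Toffoli (n + m) (2 * n + m) (2 * n + 1 + m)) ?t"
    using Suc.IH Suc.prems by simp
  also have "\<dots> = ?t(2 * n + 1 + m := (s (2 * n + 1 + m) \<noteq> (s (n + m) \<and> carry x y m)))"
  proof -
    have "\<not> 2 * n + 1 \<le> n + m"
      using Suc.prems by linarith
    then show ?thesis
      using Suc.hyps by simp
  qed
  also have "(s (2 * n + 1 + m) \<noteq> (s (n + m) \<and> carry x y m)) = carry x y (Suc m)"
    using Suc.prems assms(3)[of m] assms(4)[of m] by simp
  also have "?t(2 * n + 1 + m := carry x y (Suc m)) =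
      (\<lambda>q. if 2 * n + 1 \<le> q \<and> q < 2 * n + 1 + Suc m then carry x y (q - 2 * n) else s q)"
  proof
    fix q
    show "(?t(2 * n + 1 + m := carry x y (Suc m))) q =
        (if 2 * n + 1 \<le> q \<and> q < 2 * n + 1 + Suc m then carry x y (q - 2 * n) else s q)"
      by (cases "q = 2 * n + 1 + m") (auto simp del: carry.simps)
  qed
  finally show ?case .
qed

lemma concat_par_single: "concat (par [f] bs) = map f bs"
  by (simp add: par_def)

lemma distinct_ladder_locs:
  "distinct ((2 * n + 1) # locs (map (\<lambda>i. (n + i, 2 * n + 1 + i)) [1..<n - 1]))"
proof -
  have mem: "q \<in> set (locs (map (\<lambda>i. (n + i, 2 * n + 1 + i)) [1..<m])) \<longleftrightarrow>
      (\<exists>i\<in>{1..<m}. q = n + i \<or> q = 2 * n + 1 + i)" for m q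
    by (auto simp: locs_def)
  have "m \<le> n \<Longrightarrow> distinct (locs (map (\<lambda>i. (n + i, 2 * n + 1 + i)) [1..<m]))" for m
  proof (induction m)
    case (Suc m)
    have "locs (ps @ [(p, g)]) = locs ps @ [p, g]" for ps p g
      by (simp add: locs_def)
    with Suc show ?case
      using mem[of "n + m" m] mem[of "2 * n + 1 + m" m] by auto
  qed simp
  then show ?thesis
    using mem[of "2 * n + 1" "n - 1"] by auto
qed

text \<open>On cleared ancillas the first two layers produce generate and propagate bits, the ladder
  turns the former into carries, and the last layer restores \<open>b\<close>.\<close>

lemma run_carries:
  assumes "n \<ge> 1" "\<And>q. 2 * n + 1 \<le> q \<Longrightarrow> q < 3 * n \<Longrightarrow> \<not> s q"
  shows "run (concat (carries n)) s =
    (\<lambda>q. if 2 * n + 1 \<le> q \<and> q < 3 * n then carry s (\<lambda>i. s (n + i)) (q - 2 * n) else s q)"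
proof (cases "n = 1")
  case True
  then show ?thesis
    by (subst carries_def, subst fast_ladder.simps) (auto simp: par_def fun_eq_iff)
next
  case False
  let ?x = s and ?y = "\<lambda>i. s (n + i)"
  let ?ps = "map (\<lambda>i. (n + i, 2 * n + 1 + i)) [1..<n - 1]"
  define t0 where "t0 = run (map (\<lambda>i. Toffoli i (n + i) (2 * n + 1 + i)) [0..<n - 1]) s"
  define t where "t = run (map (\<lambda>i. CNOT i (n + i)) [0..<n - 1]) t0"
  have eqs: "2 * n + 1 + (n - 1) = 3 * n" "n + (n - 1) = 2 * n - 1"
    using assms(1) by simp_all
  have t0: "t0 = (\<lambda>q. if 2 * n + 1 \<le> q \<and> q < 3 * n
      then s q \<noteq> (s (q - (2 * n + 1)) \<and> s (q - (n + 1))) else s q)"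
    unfolding t0_def run_Toffoli_layer[OF diff_le_self] eqs ..
  have t: "t = (\<lambda>q. if 2 * n + 1 \<le> q \<and> q < 3 * n then s (q - (2 * n + 1)) \<and> s (q - (n + 1))
      else if n \<le> q \<and> q < 2 * n - 1 then s q \<noteq> s (q - n) else s q)" (is "t = ?r")
  proof
    fix q
    have tq: "t q = (if n \<le> q \<and> q < 2 * n - 1 then t0 q \<noteq> t0 (q - n) else t0 q)"
      unfolding t_def run_CNOT_layer[OF diff_le_self] eqs ..
    show "t q = ?r q"
    proof (cases "n \<le> q \<and> q < 2 * n - 1")
      case True
      then have "\<not> 2 * n + 1 \<le> q" "\<not> 2 * n + 1 \<le> q - n"
        by linarith+
      then show ?thesis
        using True by (simp add: tq t0)
    next
      case False
      then show ?thesis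
        using assms(2)[of q] by (auto simp add: tq t0)
    qed
  qed
  \<comment> \<open>The propagate bit is the exclusive or, and the generate bit the conjunction, of
    the same two bits.\<close>
  have "exclusive t ?ps"
    by (auto simp: exclusive_def t)
  then have "run (concat (fast_ladder (2 * n + 1) ?ps)) t = run (ladder (2 * n + 1) ?ps) t"
    by (intro run_fast_ladder distinct_ladder_locs)
  also have "\<dots> = (\<lambda>q. if 2 * n + 1 \<le> q \<and> q < 2 * n + 1 + (n - 1)
      then carry ?x ?y (q - 2 * n) else t q)"
    by (rule run_ladder_carry) (use assms(1) False in \<open>auto simp: t\<close>)
  finally have "run (concat (carries n)) s =
      run (map (\<lambda>i. CNOT i (n + i)) [0..<n - 1]) \<dots>"
    by (simp add: carries_def par_def t_def t0_def)
  also have "\<dots> = (\<lambda>q. if 2 * n + 1 \<le> q \<and> q < 3 * n then carry ?x ?y (q - 2 * n) else s q)"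
    unfolding run_CNOT_layer[OF diff_le_self] eqs
  proof
    fix q
    let ?u = "\<lambda>q. if 2 * n + 1 \<le> q \<and> q < 3 * n then carry ?x ?y (q - 2 * n) else t q"
    show "(if n \<le> q \<and> q < 2 * n - 1 then ?u q \<noteq> ?u (q - n) else ?u q) =
        (if 2 * n + 1 \<le> q \<and> q < 3 * n then carry ?x ?y (q - 2 * n) else s q)"
    proof (cases "n \<le> q \<and> q < 2 * n - 1")
      case True
      then have "\<not> 2 * n + 1 \<le> q" "\<not> 2 * n + 1 \<le> q - n" "\<not> n \<le> q - n"
        by linarith+
      then show ?thesis
        unfolding if_P[OF True] using True by (cases "s (q - n)") (simp_all add: t)
    next
      case False
      show ?thesis
        unfolding if_not_P[OF False] using False by (simp add: t) blast
    qed
  qed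
  finally show ?thesis .
qed

section \<open>Validity of the adder\<close>

lemma valid_par_upt:
  assumes "\<And>i. i < m \<Longrightarrow> distinct (qs i) \<and> set (qs i) \<subseteq> {..<N}"
    and "\<And>i j. i < j \<Longrightarrow> j < m \<Longrightarrow> set (qs i) \<inter> set (qs j) = {}"
    and "\<And>f i. f \<in> set fs \<Longrightarrow> i < m \<Longrightarrow>
      distinct (qubits (f i)) \<and> set (qubits (f i)) \<subseteq> set (qs i)"
  shows "valid_circuit N (par fs [0..<m])"
proof (rule valid_par)
  have "k \<le> m \<Longrightarrow> distinct (concat (map qs [0..<k]))" for k
  proof (induction k)
    case (Suc k)
    have "set (qs i) \<inter> set (qs k) = {}" if "i < k" for i
      using assms(2)[OF that] Suc.prems by simp
    then have "set (concat (map qs [0..<k])) \<inter> set (qs k) = {}"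
      by fastforce
    then show ?case
      using Suc assms(1)[of k] by simp
  qed simp
  then show "distinct (concat (map qs [0..<m]))"
    by simp
qed (use assms in auto)

lemma valid_carries:
  assumes "n \<ge> 1"
  shows "valid_circuit (3 * n) (carries n)"
proof -
  have "valid_circuit (3 * n) (par [\<lambda>i. Toffoli i (n + i) (2 * n + 1 + i), \<lambda>i. CNOT i (n + i)]
      [0..<n - 1])"
    by (rule valid_par_upt[where qs = "\<lambda>i. [i, n + i, 2 * n + 1 + i]"]) (use assms in auto)
  moreover have "valid_circuit (3 * n) (par [\<lambda>i. CNOT i (n + i)] [0..<n - 1])"
    by (rule valid_par_upt[where qs = "\<lambda>i. [i, n + i]"]) (use assms in auto)
  moreover have "valid_circuit (3 * n)
      (fast_ladder (2 * n + 1) (map (\<lambda>i. (n + i, 2 * n + 1 + i)) [1..<n - 1]))"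
    by (rule valid_fast_ladder[OF distinct_ladder_locs]) (auto simp: locs_def)
  ultimately show ?thesis
    by (simp add: carries_def)
qed

lemma valid_inverse: "valid_circuit N C \<Longrightarrow> valid_circuit N (inverse_circuit C)"
  by (auto simp: valid_circuit_def valid_layer_def inverse_circuit_def simp flip: rev_map rev_concat)

lemma valid_adder:
  assumes "n \<ge> 1"
  shows "valid_circuit (3 * n) (adder n)"
proof -
  have "valid_circuit (3 * n) (top_carry n)"
    using assms by (auto simp: top_carry_def valid_circuit_def valid_layer_def)
  moreover have "valid_circuit (3 * n) (add_carries n)"
    unfolding add_carries_def valid_append
    by (intro conjI valid_par_upt[where qs = "\<lambda>i. [i, n + i]"]
        valid_par_upt[where qs = "\<lambda>i. [2 * n + 1 + i, n + 1 + i]"]) (use assms in auto)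
  moreover have "valid_circuit (3 * n) (flip n)"
    unfolding flip_def by (rule valid_par_upt[where qs = "\<lambda>i. [n + i]"]) (use assms in auto)
  ultimately show ?thesis
    using valid_carries[OF assms] by (simp add: adder_def valid_inverse)
qed

section \<open>Correctness of the adder on bit assignments\<close>

lemma run_inverse:
  assumes "valid_circuit N C"
  shows "run (concat (inverse_circuit C)) (run (concat C) s) = s"
proof -
  have "distinct (qubits g)" if "g \<in> set (concat C)" for g
    using that assms by (auto simp: valid_circuit_def valid_layer_def distinct_concat_iff)
  then show ?thesis
    using run_rev[of "concat C" s] by (simp add: inverse_circuit_def rev_concat rev_map)
qed

lemma run_top_carry:
  assumes "distinct [a, b, z]"
  shows "h \<notin> {a, b, z} \<Longrightarrow> run [Toffoli a b z, CNOT a b, Toffoli b h z, CNOT a b] s =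
      s(z := (s z \<noteq> ((s a \<and> s b) \<noteq> ((s a \<noteq> s b) \<and> s h))))"
    and "run [Toffoli a b z, CNOT a b, CNOT a b] s = s(z := (s z \<noteq> (s a \<and> s b)))"
  using assms by (auto simp: fun_eq_iff)

text \<open>The states \<open>t1\<close> to \<open>t4\<close> follow the computation up to the first
  flip. Uncomputing is verified forwards: \<open>carries n\<close> takes \<open>t5\<close> to
  \<open>t4\<close>, so its inverse takes \<open>t4\<close> to \<open>t5\<close>.\<close>

lemma run_adder:
  assumes "n \<ge> 1" "\<And>q. 2 * n + 1 \<le> q \<Longrightarrow> q < 3 * n \<Longrightarrow> \<not> s q"
  defines "c \<equiv> carry s (\<lambda>i. s (n + i))"
  shows "run (concat (adder n)) s =
    (\<lambda>q. if n \<le> q \<and> q < 2 * n then (s q \<noteq> s (q - n)) \<noteq> c (q - n)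
      else if q = 2 * n then s q \<noteq> c n else s q)"
proof -
  let ?anc = "\<lambda>q. 2 * n + 1 \<le> q \<and> q < 3 * n"
  define t1 where "t1 = run (concat (carries n)) s"
  define t2 where "t2 = run (concat (top_carry n)) t1"
  define t3 where "t3 = run (concat (add_carries n)) t2"
  define t4 where "t4 = run (concat (flip n)) t3"
  \<comment> \<open>The intended result of uncomputing: \<open>t4\<close> with cleared
    ancillas.\<close>
  define t5 where "t5 = (\<lambda>q. if ?anc q then False else t4 q)"
  have t1: "t1 = (\<lambda>q. if ?anc q then c (q - 2 * n) else s q)"
    unfolding t1_def c_def by (rule run_carries[OF assms(1,2)])
  have t2: "t2 = (\<lambda>q. if ?anc q then c (q - 2 * n) else if q = 2 * n then s q \<noteq> c n else s q)"
  proof -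
    obtain k where k: "n = Suc k"
      using assms(1) by (cases n) auto
    have c: "c n = ((s k \<and> s (n + k)) \<noteq> ((s k \<noteq> s (n + k)) \<and> c k))"
      by (simp add: k c_def)
    have t1_at: "t1 k = s k" "t1 (n + k) = s (n + k)" "t1 (2 * n) = s (2 * n)"
      by (simp_all add: t1 k)
    have "t2 = t1(2 * n := (s (2 * n) \<noteq> c n))"
    proof (cases "k = 0")
      case True
      have "c 0 = False"
        by (simp add: c_def)
      have "top_carry n = [[Toffoli k (n + k) (2 * n)], [CNOT k (n + k)], [], [CNOT k (n + k)]]"
        using True by (simp add: top_carry_def k)
      then have "t2 = t1(2 * n := (t1 (2 * n) \<noteq> (t1 k \<and> t1 (n + k))))"
        using run_top_carry(2)[of k "n + k" "2 * n" t1] by (simp add: t2_def k)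
      then have "t2 = t1(2 * n := (s (2 * n) \<noteq> (s k \<and> s (n + k))))"
        by (simp only: t1_at)
      then show ?thesis
        using True c \<open>c 0 = False\<close> by simp
    next
      case False
      have "top_carry n = [[Toffoli k (n + k) (2 * n)], [CNOT k (n + k)],
          [Toffoli (n + k) (2 * n + k) (2 * n)], [CNOT k (n + k)]]"
        using False by (simp add: top_carry_def k)
      then have "t2 = t1(2 * n := (t1 (2 * n) \<noteq>
          ((t1 k \<and> t1 (n + k)) \<noteq> ((t1 k \<noteq> t1 (n + k)) \<and> t1 (2 * n + k)))))"
        using False run_top_carry(1)[of k "n + k" "2 * n" "2 * n + k" t1]
        by (simp add: t2_def k)
      moreover have "t1 (2 * n + k) = c k"
        using False by (simp add: t1 k)
      ultimately show ?thesis
        using c by (simp add: t1_at)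
    qed
    then show ?thesis
      by (intro ext) (simp add: t1)
  qed
  have t3: "t3 = (\<lambda>q. if n \<le> q \<and> q < 2 * n then (s q \<noteq> s (q - n)) \<noteq> c (q - n) else t2 q)"
  proof
    fix q
    let ?u = "\<lambda>q. if n \<le> q \<and> q < n + n then t2 q \<noteq> t2 (q - n) else t2 q"
    have t3q: "t3 q = (if n + 1 \<le> q \<and> q < n + 1 + (n - 1) then ?u q \<noteq> ?u (q + n) else ?u q)"
      unfolding t3_def add_carries_def concat_append fold_append comp_def concat_par_single
        run_CNOT_carry_layer[OF order_refl] run_CNOT_layer[OF order_refl] ..
    consider "q < n \<or> 2 * n \<le> q" | "q = n" | "n < q" "q < 2 * n"
      by linarith
    then show "t3 q = (if n \<le> q \<and> q < 2 * n then (s q \<noteq> s (q - n)) \<noteq> c (q - n) else t2 q)"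
    proof cases
      case 1
      then have "\<not> (n + 1 \<le> q \<and> q < n + 1 + (n - 1))" "\<not> (n \<le> q \<and> q < n + n)"
        "\<not> (n \<le> q \<and> q < 2 * n)"
        by linarith+
      then show ?thesis
        by (simp only: t3q if_False)
    next
      case 2
      have "c 0 = False"
        by (simp add: c_def)
      with 2 show ?thesis
        unfolding t3q using assms(1) by (simp add: t2)
    next
      case 3
      have "q - n < n"
        using 3 by linarith
      with 3 have "t2 q = s q" "t2 (q - n) = s (q - n)" "t2 (q + n) = c (q - n)"
        by (simp_all add: t2)
      moreover have "?u q = (t2 q \<noteq> t2 (q - n))" "?u (q + n) = t2 (q + n)"
        "n + 1 \<le> q \<and> q < n + 1 + (n - 1)"
        using 3 by simp_all
      ultimately have "t3 q = ((s q \<noteq> s (q - n)) \<noteq> c (q - n))"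
        unfolding t3q by (simp only: if_True simp_thms)
      with 3 show ?thesis
        by simp
    qed
  qed
  have t4: "t4 = (\<lambda>q. if n \<le> q \<and> q < 2 * n - 1 then \<not> t3 q else t3 q)"
    unfolding t4_def flip_def concat_par_single run_X_layer using assms(1)
    by (auto simp: fun_eq_iff)
  have "carry t5 (\<lambda>i. t5 (n + i)) j = c j" if "j < n" for j
  proof -
    have "carry t5 (\<lambda>i. t5 (n + i)) j = carry s (\<lambda>i. \<not> ((s (n + i) \<noteq> s i) \<noteq> c i)) j"
      \<comment> \<open>Only positions below \<open>j \<le> n - 1\<close> enter this carry, and
        there the sum bits are complemented.\<close>
      by (rule carry_cong) (use that in \<open>auto simp: t5_def t4 t3 t2\<close>)
    also have "\<dots> = c j"
      unfolding c_def by (rule carry_not_sum)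
    finally show ?thesis .
  qed
  note carry_t5 = this
  have t5_carries: "run (concat (carries n)) t5 =
      (\<lambda>q. if ?anc q then carry t5 (\<lambda>i. t5 (n + i)) (q - 2 * n) else t5 q)"
    by (rule run_carries[OF assms(1)]) (simp add: t5_def)
  have "run (concat (carries n)) t5 q = t4 q" for q
  proof (cases "?anc q")
    case True
    then have "\<not> q < 2 * n - 1" "\<not> q < 2 * n" "q \<noteq> 2 * n" "q - 2 * n < n"
      by linarith+
    with True have "t4 q = c (q - 2 * n)" "q - 2 * n < n"
      by (simp_all add: t4 t3 t2)
    with True show ?thesis
      by (simp add: t5_carries carry_t5)
  next
    case False
    then have "t5 q = t4 q"
      by (simp only: t5_def if_False)
    with False show ?thesis
      by (simp only: t5_carries if_False)
  qed
  then have "run (concat (carries n)) t5 = t4" ..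
  then have "run (concat (inverse_circuit (carries n))) t4 = t5"
    using run_inverse[OF valid_carries[OF assms(1)], of t5] by simp
  then have "run (concat (adder n)) s = run (concat (flip n)) t5"
    by (simp add: adder_def t1_def t2_def t3_def t4_def)
  also have "\<dots> = (\<lambda>q. if n \<le> q \<and> q < 2 * n - 1 then \<not> t5 q else t5 q)"
    unfolding flip_def concat_par_single run_X_layer using assms(1)
    by (auto simp: fun_eq_iff)
  also have "\<dots> = (\<lambda>q. if n \<le> q \<and> q < 2 * n then (s q \<noteq> s (q - n)) \<noteq> c (q - n)
      else if q = 2 * n then s q \<noteq> c n else s q)"
    using assms(2) by (auto simp: fun_eq_iff t5_def t4 t3 t2)
  finally show ?thesis .
qed

section \<open>From bit assignments to bit lists and state vectors\<close>

lemma length_gate_map [simp]: "length (gate_map g v) = length v"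
  by (cases g) auto

lemma length_fold_gate_map [simp]: "length (fold gate_map gs v) = length v"
  by (induction gs arbitrary: v) auto

lemma nth_gate_map:
  assumes "set (qubits g) \<subseteq> {..<length v}" "\<And>i. i < length v \<Longrightarrow> v ! i = s i" "i < length v"
  shows "gate_map g v ! i = act g s i"
  using assms by (cases g) (auto simp: nth_list_update)

text \<open>Gates within the range of the list read and write only positions on which list and
  assignment agree.\<close>

lemma nth_fold_gate_map:
  assumes "\<And>g. g \<in> set gs \<Longrightarrow> set (qubits g) \<subseteq> {..<length v}"
    and "\<And>i. i < length v \<Longrightarrow> v ! i = s i" "i < length v"
  shows "fold gate_map gs v ! i = run gs s i"
  using assms
proof (induction gs arbitrary: s v)
  case (Cons g gs)
  have "gate_map g v ! j = act g s j" if "j < length v" for j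
    by (rule nth_gate_map) (use Cons.prems that in auto)
  then have "fold gate_map gs (gate_map g v) ! i = run gs (act g s) i"
    by (intro Cons.IH) (use Cons.prems in auto)
  then show ?case
    by simp
qed simp

lemma fold_gate_map_adder:
  assumes "n \<ge> 1" "length v = 2 * n + 1"
  shows "fold gate_map (concat (adder n)) (v @ replicate (n - 1) False) =
    add_map n v @ replicate (n - 1) False"
proof (rule nth_equalityI)
  let ?v = "v @ replicate (n - 1) False"
  let ?c = "carry (\<lambda>i. v ! i) (\<lambda>i. v ! (n + i))"
  \<comment> \<open>Beyond the list the values of \<open>s\<close> are unspecified, so its
    description is restricted to \<open>i < 3 * n\<close>.\<close>
  define s where "s = (\<lambda>i. ?v ! i)"
  have s: "s i = (if i < 2 * n + 1 then v ! i else False)" if "i < 3 * n" for i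
    using that assms by (auto simp: s_def nth_append)
  have len: "length ?v = 3 * n"
    using assms by simp
  then show "length (fold gate_map (concat (adder n)) ?v) =
      length (add_map n v @ replicate (n - 1) False)"
    using assms by (simp add: add_map_def Let_def to_bits_def)
  fix i assume "i < length (fold gate_map (concat (adder n)) ?v)"
  then have i: "i < 3 * n"
    using len by simp
  have "set (qubits g) \<subseteq> {..<3 * n}" if "g \<in> set (concat (adder n))" for g
    using valid_adder[OF assms(1)] that by (fastforce simp: valid_circuit_def valid_layer_def)
  then have "fold gate_map (concat (adder n)) ?v ! i = run (concat (adder n)) s i"
    using i len by (intro nth_fold_gate_map) (auto simp: s_def)
  also have "\<dots> = (if n \<le> i \<and> i < 2 * n
      then (s i \<noteq> s (i - n)) \<noteq> carry s (\<lambda>i. s (n + i)) (i - n)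
      else if i = 2 * n then s i \<noteq> carry s (\<lambda>i. s (n + i)) n else s i)"
    by (subst run_adder[OF assms(1)]) (auto simp: s)
  also have "\<dots> = (add_map n v @ replicate (n - 1) False) ! i"
  proof -
    have carry: "carry s (\<lambda>i. s (n + i)) j = ?c j" if "j \<le> n" for j
      by (rule carry_cong) (use that in \<open>auto simp: s\<close>)
    have "i < n \<or> (\<exists>j<n. i = n + j) \<or> i = 2 * n \<or> (\<exists>j<n - 1. i = 2 * n + 1 + j)"
      using i by presburger
    then show ?thesis
      using i assms carry[of "i - n"] carry[of n]
      by (elim disjE exE conjE) (simp_all add: add_map_carry s nth_append)
  qed
  finally show "fold gate_map (concat (adder n)) ?v ! i =
    (add_map n v @ replicate (n - 1) False) ! i" .
qed

lemma lin_op_states: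
  assumes "\<And>x. length (f x) = length x"
  shows "lin_op N f \<psi> \<in> states N"
proof -
  have "lin_op N f \<psi> y = 0" if "length y \<noteq> N" for y
  proof -
    have "{x. length x = N \<and> f x = y} = {}"
      using assms that by auto
    then show ?thesis
      by (simp only: lin_op_def sum.empty)
  qed
  then show ?thesis
    by (simp add: states_def)
qed

text \<open>Grouping the preimages \<open>u\<close> by the intermediate basis state
  \<open>g u\<close> turns the double sum into a single one.\<close>

lemma lin_op_comp:
  assumes "\<And>x. length (g x) = length x"
  shows "lin_op N f (lin_op N g \<psi>) = lin_op N (\<lambda>x. f (g x)) \<psi>"
proof
  fix y
  let ?S = "{u. length u = N \<and> f (g u) = y}" and ?T = "{x. length x = N \<and> f x = y}"
  have "finite ?S" "finite ?T"
    by (rule finite_subset[OF _ finite_basis[of N]]; auto)+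
  moreover have "g ` ?S \<subseteq> ?T"
    using assms by auto
  ultimately have "(\<Sum>x\<in>?T. sum \<psi> {u \<in> ?S. g u = x}) = sum \<psi> ?S"
    by (rule sum.group)
  moreover have "{u \<in> ?S. g u = x} = {u. length u = N \<and> g u = x}" if "x \<in> ?T" for x
    using that by auto
  ultimately show "lin_op N f (lin_op N g \<psi>) y = lin_op N (\<lambda>x. f (g x)) \<psi> y"
    by (simp add: lin_op_def)
qed

text \<open>Even the empty circuit requires \<open>\<psi> \<in> states N\<close>:
  \<open>lin_op N\<close> discards amplitudes of lists of other lengths.\<close>

lemma fold_lin_op:
  assumes "\<psi> \<in> states N"
  shows "fold (\<lambda>g. lin_op N (gate_map g)) gs \<psi> = lin_op N (fold gate_map gs) \<psi>"
  using assms
proof (induction gs arbitrary: \<psi>)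
  case Nil
  have "{x. length x = N \<and> x = y} = (if length y = N then {y} else {})" for y :: "bool list"
    by auto
  with Nil show ?case
    by (auto simp: lin_op_def states_def fun_eq_iff)
next
  case (Cons g gs)
  then show ?case
    by (simp add: lin_op_states lin_op_comp comp_def)
qed

text \<open>Only lists ending in \<open>k\<close> zeros carry amplitude, and on these
  \<open>F\<close> acts as \<open>f\<close> and keeps the zeros. This lifts the statement on basis
  states to superpositions.\<close>

lemma lin_op_tensor:
  assumes "\<And>u. length u = M \<Longrightarrow> F (u @ replicate k False) = f u @ replicate k False"
    and "\<And>u. length u = M \<Longrightarrow> length (f u) = M"
  shows "lin_op (M + k) F (tensor M \<psi> (ket (replicate k False))) =
    tensor M (lin_op M f \<psi>) (ket (replicate k False))"
proof
  fix y
  let ?r = "replicate k False"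
  let ?S = "{x. length x = M + k \<and> F x = y}"
  let ?U = "{u. length u = M \<and> F (u @ ?r) = y}"
  have fin: "finite ?S"
    by (rule finite_subset[OF _ finite_basis[of "M + k"]]) auto
  have "lin_op (M + k) F (tensor M \<psi> (ket ?r)) y =
      (\<Sum>x\<in>?S. tensor M \<psi> (ket ?r) x)"
    by (simp add: lin_op_def)
  also have "\<dots> = (\<Sum>x\<in>(\<lambda>u. u @ ?r) ` ?U. tensor M \<psi> (ket ?r) x)"
  proof (rule sum.mono_neutral_right[OF fin])
    show "(\<lambda>u. u @ ?r) ` ?U \<subseteq> ?S"
      by auto
    show "\<forall>x \<in> ?S - (\<lambda>u. u @ ?r) ` ?U. tensor M \<psi> (ket ?r) x = 0"
    proof
      fix x assume x: "x \<in> ?S - (\<lambda>u. u @ ?r) ` ?U"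
      have "drop M x \<noteq> ?r"
      proof
        assume "drop M x = ?r"
        then have "x = take M x @ ?r"
          by (metis append_take_drop_id)
        moreover from this have "take M x \<in> ?U"
          using x by auto
        ultimately show False
          using x by blast
      qed
      then show "tensor M \<psi> (ket ?r) x = 0"
        by (simp add: tensor_def ket_def)
    qed
  qed
  also have "\<dots> = (\<Sum>u\<in>?U. tensor M \<psi> (ket ?r) (u @ ?r))"
    by (subst sum.reindex) (auto simp: inj_on_def)
  also have "\<dots> = (\<Sum>u\<in>?U. \<psi> u)"
    by (rule sum.cong) (auto simp: tensor_def ket_def)
  also have "\<dots> = tensor M (lin_op M f \<psi>) (ket ?r) y"
  proof (cases "drop M y = ?r")
    case True
    have "F (u @ ?r) = y \<longleftrightarrow> f u = take M y" if "length u = M" for u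
      using assms[OF that] True by (metis append_eq_conv_conj append_take_drop_id)
    then have "?U = {u. length u = M \<and> f u = take M y}"
      by auto
    then show ?thesis
      using True by (simp add: tensor_def ket_def lin_op_def)
  next
    case False
    \<comment> \<open>Every image of a padded list ends in zeros again, so \<open>y\<close> is not
      attained.\<close>
    then have "?U = {}"
      using assms by auto
    then show ?thesis
      using False unfolding \<open>?U = {}\<close> by (simp add: tensor_def ket_def)
  qed
  finally show "lin_op (M + k) F (tensor M \<psi> (ket ?r)) y =
    tensor M (lin_op M f \<psi>) (ket ?r) y" .
qed

lemma implements_adder:
  assumes "n \<ge> 1"
  shows "implements_Add n (n - 1) (adder n)"
  unfolding implements_Add_def
proof (intro conjI ballI)
  let ?N = "2 * n + 1 + (n - 1)" and ?r = "ket (replicate (n - 1) False)"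
  have N: "?N = 3 * n"
    using assms by simp
  show "valid_circuit ?N (adder n)"
    unfolding N by (rule valid_adder[OF assms])
  fix \<psi> assume \<psi>: "\<psi> \<in> states (2 * n + 1)"
  have "tensor (2 * n + 1) \<psi> ?r \<in> states ?N"
    unfolding states_def tensor_def
  proof (intro CollectI allI impI)
    fix x :: "bool list" assume x: "length x \<noteq> ?N"
    show "\<psi> (take (2 * n + 1) x) * ?r (drop (2 * n + 1) x) = 0"
    proof (rule ccontr)
      assume "\<not> ?thesis"
      then have nz: "\<psi> (take (2 * n + 1) x) \<noteq> 0"
        and "drop (2 * n + 1) x = replicate (n - 1) False"
        by (auto simp: ket_def split: if_splits)
      moreover have "length (take (2 * n + 1) x) = 2 * n + 1"
        using nz \<psi> unfolding states_def by blast
      ultimately have "length (take (2 * n + 1) x) = 2 * n + 1"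
        "length (drop (2 * n + 1) x) = n - 1"
        by (simp_all only: length_replicate)
      then show False
        using x by (metis append_take_drop_id length_append)
    qed
  qed
  then have "circuit_op ?N (adder n) (tensor (2 * n + 1) \<psi> ?r) =
      lin_op ?N (fold gate_map (concat (adder n))) (tensor (2 * n + 1) \<psi> ?r)"
    by (simp only: circuit_op_def fold_lin_op)
  also have "\<dots> = tensor (2 * n + 1) (Add n \<psi>) ?r"
    unfolding Add_def
  proof (rule lin_op_tensor)
    show "fold gate_map (concat (adder n)) (u @ replicate (n - 1) False) =
        add_map n u @ replicate (n - 1) False" if "length u = 2 * n + 1" for u
      by (rule fold_gate_map_adder[OF assms that])
  qed (simp add: add_map_def to_bits_def Let_def)
  finally show "circuit_op ?N (adder n) (tensor (2 * n + 1) \<psi> ?r) =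
      tensor (2 * n + 1) (Add n \<psi>) ?r" .
qed

section \<open>Cost of the adder and the asymptotic bounds\<close>

lemma toffoli_count_inverse: "toffoli_count (inverse_circuit C) = toffoli_count C"
proof -
  have "toffoli_count (inverse_circuit C) = length (filter is_toffoli (rev (concat C)))"
    by (simp add: toffoli_count_def inverse_circuit_def rev_concat rev_map)
  then show ?thesis
    by (simp add: toffoli_count_def flip: rev_filter)
qed

lemma toffoli_depth_inverse: "toffoli_depth (inverse_circuit C) = toffoli_depth C"
  by (simp add: toffoli_depth_def inverse_circuit_def filter_map comp_def flip: rev_filter)

lemma no_toffoli_par:
  "toffoli_count (par [\<lambda>i. CNOT (f i) (g i)] bs) = 0"
  "toffoli_depth (par [\<lambda>i. CNOT (f i) (g i)] bs) = 0"
  "toffoli_count (par [\<lambda>i. Pauli_X (f i)] bs) = 0"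
  "toffoli_depth (par [\<lambda>i. Pauli_X (f i)] bs) = 0"
  by (auto simp: toffoli_count_def toffoli_depth_def par_def filter_empty_conv)

text \<open>The carries are computed and uncomputed at a cost of at most \<open>16 * n\<close> each;
  the final carry adds at most 2.\<close>

lemma toffoli_count_adder: "toffoli_count (adder n) \<le> 32 * n + 2"
proof -
  let ?ps = "map (\<lambda>i. (n + i, 2 * n + 1 + i)) [1..<n - 1]"
  have "toffoli_count (par [\<lambda>i. Toffoli i (n + i) (2 * n + 1 + i), \<lambda>i. CNOT i (n + i)]
      [0..<n - 1]) \<le> 2 * n"
    by (rule order_trans[OF toffoli_count_par]) simp
  moreover have "toffoli_count (fast_ladder (2 * n + 1) ?ps) \<le> 14 * n"
    by (rule order_trans[OF toffoli_count_fast_ladder]) simp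
  ultimately have "toffoli_count (carries n) \<le> 16 * n"
    by (simp add: carries_def no_toffoli_par)
  moreover have "toffoli_count (top_carry n) \<le> 2"
    by (simp add: toffoli_count_def top_carry_def)
  ultimately show ?thesis
    by (simp add: adder_def add_carries_def flip_def no_toffoli_par toffoli_count_inverse)
qed

text \<open>Twice the depth \<open>3 + 21 * log 2 n\<close> of the carries, plus 4 layers for the
  final carry.\<close>

lemma toffoli_depth_adder:
  assumes "n \<ge> 1"
  shows "real (toffoli_depth (adder n)) \<le> 10 + 42 * log 2 (real n)"
proof -
  let ?ps = "map (\<lambda>i. (n + i, 2 * n + 1 + i)) [1..<n - 1]"
  have "toffoli_depth (par [\<lambda>i. Toffoli i (n + i) (2 * n + 1 + i), \<lambda>i. CNOT i (n + i)]
      [0..<n - 1]) \<le> 2"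
    by (rule order_trans[OF toffoli_depth_le]) (simp add: par_def)
  moreover have "max 1 (real (length ?ps)) \<le> real n"
    using assms by auto
  then have "log 2 (max 1 (real (length ?ps))) \<le> log 2 (real n)"
    by (intro log_mono) auto
  then have "real (toffoli_depth (fast_ladder (2 * n + 1) ?ps)) \<le> 1 + 21 * log 2 (real n)"
    using toffoli_depth_fast_ladder[of "2 * n + 1" ?ps] by linarith
  ultimately have "real (toffoli_depth (carries n)) \<le> 3 + 21 * log 2 (real n)"
    by (simp add: carries_def no_toffoli_par)
  moreover have "toffoli_depth (top_carry n) \<le> 4"
    by (rule order_trans[OF toffoli_depth_le]) (simp add: top_carry_def)
  ultimately show ?thesis
    by (simp add: adder_def add_carries_def flip_def no_toffoli_par toffoli_depth_inverse)
qed

theorem mainTheorem2: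
  "\<exists>C :: nat \<Rightarrow> circuit.
     (\<forall>n \<ge> 1. implements_Add n (n - 1) (C n)) \<and>
     (\<lambda>n. real (toffoli_count (C n))) \<in> O(\<lambda>n. real n * log 2 (real n)) \<and>
     (\<lambda>n. real (toffoli_depth (C n))) \<in> O(\<lambda>n. (log 2 (real n))\<^sup>2)"
proof (intro exI[of _ adder] conjI)
  \<comment> \<open>From \<open>n = 2\<close> on the logarithm is at least 1, so the linear count
    and the logarithmic depth imply the weaker bounds claimed.\<close>
  have log: "log 2 (real n) \<ge> 1" if "n \<ge> 2" for n :: nat
    using that by (simp add: le_log_iff)
  show "\<forall>n \<ge> 1. implements_Add n (n - 1) (adder n)"
    using implements_adder by blast
  show "(\<lambda>n. real (toffoli_count (adder n))) \<in> O(\<lambda>n. real n * log 2 (real n))"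
  \<comment> \<open>The constant is 32 + 2, from \<open>32 * n + 2 \<le> 34 * n\<close>.\<close>
  proof (rule bigoI[of _ 34], rule eventually_sequentiallyI[of 2])
    fix n :: nat assume n: "n \<ge> 2"
    have "real (toffoli_count (adder n)) \<le> 34 * real n * 1"
      using toffoli_count_adder[of n] n by simp
    also have "\<dots> \<le> 34 * real n * log 2 (real n)"
      using log[OF n] by (intro mult_left_mono) auto
    finally show "norm (real (toffoli_count (adder n))) \<le> 34 * norm (real n * log 2 (real n))"
      using log[OF n] by (simp add: abs_mult)
  qed
  show "(\<lambda>n. real (toffoli_depth (adder n))) \<in> O(\<lambda>n. (log 2 (real n))\<^sup>2)"
  \<comment> \<open>The constant is 10 + 42, the additive 10 being absorbed by the
    logarithm.\<close>
  proof (rule bigoI[of _ 52], rule eventually_sequentiallyI[of 2])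
    fix n :: nat assume n: "n \<ge> 2"
    have "real (toffoli_depth (adder n)) \<le> 52 * (log 2 (real n) * 1)"
      using toffoli_depth_adder[OF order_trans[OF one_le_numeral n]] log[OF n] by linarith
    also have "\<dots> \<le> 52 * (log 2 (real n))\<^sup>2"
      using log[OF n] unfolding power2_eq_square by (intro mult_left_mono) auto
    finally show "norm (real (toffoli_depth (adder n))) \<le> 52 * norm ((log 2 (real n))\<^sup>2)"
      by simp
  qed
qed

end
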